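(* Let $k\ge 3$, let $n\ge 1$, and let $j$ be the integer with $0\le j\le k-1$ and $n\equiv j \pmod k$. If $j\neq 0$, then the two-letter word $(n-j)\,n$ is a suffix of $\varphi_k^n(0)$. If $j=0$, then the two-letter word $(n-k+1)\,n$ is a suffix of $\varphi_k^n(0)$.
   Context: The alphabet is $\mathbb{N}=\{0,1,2,\dots\}$. For an integer $k\ge 3$, $\varphi_k$ is the morphism of $\mathbb{N}^*$ defined on letters, for $i\ge 0$ and $0\le j\le k-1$, by $\varphi_k(ki+j)=(ki)(ki+j+1)$ (two letters) if $0\le j\le k-2$, and $\varphi_k(ki+k-1)=(ki+k)$ (one letter). *)

theory Defs
  imports "HOL-Library.Sublist" "HOL-Number_Theory.Cong"
begin

(* A letter a is decomposed as a = k * i + j with i = a div k and j = a mod k;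
   the definitions are meant for k \<ge> 3. *)
definition phi_letter :: "nat \<Rightarrow> nat \<Rightarrow> nat list" where
  "phi_letter k a =
    (let i = a div k; j = a mod k
     in if j \<le> k - 2 then [k * i, k * i + j + 1] else [k * i + k])"

definition phi :: "nat \<Rightarrow> nat list \<Rightarrow> nat list" where
  "phi k w = concat (map (phi_letter k) w)"

lemma phi_append: "phi k (u @ v) = phi k u @ phi k v"
  by (simp add: phi_def)

lemma phi_two_letters:
  assumes "k \<ge> 3" "j \<le> k - 2"
  shows "phi k [k * i + j] = [k * i, k * i + j + 1]"
  using assms by (simp add: phi_def phi_letter_def)

lemma phi_one_letter:
  assumes "k \<ge> 3"
  shows "phi k [k * i + (k - 1)] = [k * i + k]"
  using assms by (simp add: phi_def phi_letter_def Let_def del: Nat.add_diff_assoc)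

end

theory Submission
  imports Defs
begin

text \<open>Induction on \<open>n\<close>, since \<open>phi\<close> maps suffixes to suffixes. Write
  the last letter as \<open>n = k*i + j\<close>. If \<open>j \<le> k - 2\<close>, its image
  \<open>(k*i)(n+1)\<close> already is the required suffix. If \<open>j = k - 1\<close>, its image
  is the single letter \<open>n+1\<close>, and the letter before it comes from the penultimate
  letter \<open>k*i\<close>, whose image ends in \<open>k*i + 1\<close>.\<close>

lemma suffix_phi: "suffix u w \<Longrightarrow> suffix (phi k u) (phi k w)"
  by (auto simp: suffix_def phi_append)

lemma phi_Cons: "phi k (a # w) = phi k [a] @ phi k w"
  by (simp add: phi_def)

text \<open>Both residue cases share one statement because the step to a multiple of
  \<open>k\<close> uses the penultimate letter given by the nonzero case. The index is
  \<open>Suc n\<close> because the zeroth iterate \<open>[0]\<close> has only one letter.\<close>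

lemma suffix_phi_funpow:
  fixes k n :: nat
  assumes k: "k \<ge> 3"
  shows "suffix [if Suc n mod k = 0 then Suc n - k + 1 else Suc n - Suc n mod k, Suc n]
           ((phi k ^^ Suc n) [0])"
proof (induction n)
  case 0
  show ?case
    using k phi_two_letters[of k 0 0] by simp
next
  case (Suc n)
  define i j where "i = Suc n div k" and "j = Suc n mod k"
  have n: "Suc n = k * i + j"
    unfolding i_def j_def by simp
  have "j < k"
    using k by (simp add: j_def)
  then consider "j \<le> k - 2" | "j = k - 1"
    by linarith
  then show ?case
  proof cases
    case 1
    \<comment> \<open>A two-letter image makes the penultimate letter irrelevant.\<close>
    have "suffix [Suc n] ((phi k ^^ Suc n) [0])"
      by (rule suffix_order.trans[OF _ Suc.IH]) (simp add: suffix_Cons)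
    from suffix_phi[OF this, of k]
    have "suffix [k * i, k * i + j + 1] ((phi k ^^ Suc (Suc n)) [0])"
      using phi_two_letters[OF k 1] by (simp add: n)
    moreover have "Suc (Suc n) mod k = Suc j"
      using 1 k by (simp add: j_def mod_Suc)
    ultimately show ?thesis
      using n by simp
  next
    case 2
    \<comment> \<open>Here \<open>j = k - 1\<close> is nonzero, so the induction hypothesis gives
      the penultimate letter \<open>Suc n - j = k * i\<close>.\<close>
    then have "suffix [k * i, Suc n] ((phi k ^^ Suc n) [0])"
      using Suc.IH k n unfolding j_def[symmetric] by simp
    from suffix_phi[OF this, of k]
    have "suffix (phi k [k * i] @ phi k [Suc n]) ((phi k ^^ Suc (Suc n)) [0])"
      by (simp add: phi_Cons[of k "k * i" "[Suc n]"])
    moreover have "phi k [k * i] = [k * i, k * i + 1]"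
      using phi_two_letters[OF k, of 0 i] by simp
    moreover have "phi k [Suc n] = [k * i + k]"
      using phi_one_letter[OF k, of i] n 2 by simp
    ultimately have "suffix [k * i, k * i + 1, k * i + k] ((phi k ^^ Suc (Suc n)) [0])"
      by simp
    then have "suffix [k * i + 1, k * i + k] ((phi k ^^ Suc (Suc n)) [0])"
      by (rule suffix_ConsD)
    \<comment> \<open>The new last letter is a multiple of \<open>k\<close>, and
      \<open>k * i + 1\<close> is that letter minus \<open>k\<close> plus 1.\<close>
    moreover have "Suc (Suc n) = k * i + k"
      using n 2 k by simp
    ultimately show ?thesis
      by simp
  qed
qed

theorem theorem3p3:
  fixes k n j :: nat
  assumes "k \<ge> 3" and "n \<ge> 1" and "j \<le> k - 1" and "[n = j] (mod k)"
  shows "(j \<noteq> 0 \<longrightarrow> suffix [n - j, n] ((phi k ^^ n) [0])) \<and>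
         (j = 0 \<longrightarrow> suffix [n - k + 1, n] ((phi k ^^ n) [0]))"
proof -
  have "n mod k = j"
    using assms by (simp add: cong_def)
  moreover obtain m where "n = Suc m"
    using assms(2) by (cases n) auto
  ultimately show ?thesis
    using suffix_phi_funpow[OF assms(1), of m] by (auto split: if_splits)
qed

end
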